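(* Let $\lambda$ be a nonzero real number. For every integer $r\ge1$ and every integer $n\ge0$, $$ \sum_{k=0}^{n}(k)_{r,\lambda}=\sum_{j=0}^{r}(-1)^{r-j}j!{r \brace j}_{-\lambda}\binom{n+j}{j+1}. $$
   Context: For a real parameter $\mu$ the degenerate falling factorials are $(x)_{0,\mu}=1$ and $(x)_{n,\mu}=x(x-\mu)\cdots(x-(n-1)\mu)$ for $n\ge1$; $(x)_n=(x)_{n,1}$ is the usual falling factorial and $\binom{y}{m}=(y)_m/m!$. The degenerate Stirling numbers of the second kind ${n \brace k}_{\mu}$ are defined by $(x)_{n,\mu}=\sum_{k=0}^{n}{n \brace k}_{\mu}(x)_k$ (so ${r\brace j}_{-\lambda}$ corresponds to $\mu=-\lambda$). *)

theory Defs
  imports Complex_Main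
begin

definition degen_ffact :: "real \<Rightarrow> real \<Rightarrow> nat \<Rightarrow> real" where
  "degen_ffact \<mu> x n = (\<Prod>i<n. x - real i * \<mu>)"

abbreviation falling_fact :: "real \<Rightarrow> nat \<Rightarrow> real" where
  "falling_fact x n \<equiv> degen_ffact 1 x n"

text \<open>The numbers with index \<open>k > n\<close>, which the defining expansion does not mention, are
  set to zero; with this convention the coefficient sequence exists and is unique
  (lemma \<open>degen_Stirling2_ex1\<close>).\<close>

definition degen_Stirling2 :: "real \<Rightarrow> nat \<Rightarrow> nat \<Rightarrow> real" where
  "degen_Stirling2 \<mu> n =
     (THE c. (\<forall>x. degen_ffact \<mu> x n = (\<Sum>k=0..n. c k * falling_fact x k)) \<and> (\<forall>k>n. c k = 0))"

lemma degen_ffact_0 [simp]: "degen_ffact \<mu> x 0 = 1"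
  by (simp add: degen_ffact_def)

lemma degen_ffact_Suc: "degen_ffact \<mu> x (Suc n) = degen_ffact \<mu> x n * (x - real n * \<mu>)"
  by (simp add: degen_ffact_def)

lemma falling_fact_eq_0: "m < k \<Longrightarrow> falling_fact (real m) k = 0"
  by (auto simp: degen_ffact_def)

lemma falling_fact_self_nz: "falling_fact (real m) m \<noteq> 0"
  by (auto simp: degen_ffact_def)

lemma degen_Stirling2_ex:
  "\<exists>c. (\<forall>x. degen_ffact \<mu> x n = (\<Sum>k=0..n. c k * falling_fact x k)) \<and> (\<forall>k>n. c k = (0::real))"
proof (induction n)
  case 0
  show ?case by (rule exI[of _ "\<lambda>k. if k = 0 then 1 else 0"]) auto
next
  case (Suc n)
  then obtain c where c: "\<And>x. degen_ffact \<mu> x n = (\<Sum>k=0..n. c k * falling_fact x k)"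
    and z: "\<And>k. k > n \<Longrightarrow> c k = 0" by blast
  define d where "d k = (if k = 0 then 0 else c (k - 1)) + (real k - real n * \<mu>) * c k" for k
  have "degen_ffact \<mu> x (Suc n) = (\<Sum>k=0..Suc n. d k * falling_fact x k)" for x
  proof -
    have "degen_ffact \<mu> x (Suc n) = (\<Sum>k=0..n. c k * falling_fact x k * (x - real n * \<mu>))"
      by (simp add: degen_ffact_Suc c sum_distrib_right)
    also have "\<dots> = (\<Sum>k=0..n. c k * falling_fact x (Suc k)
        + (real k - real n * \<mu>) * c k * falling_fact x k)"
      by (rule sum.cong) (auto simp: degen_ffact_Suc algebra_simps)
    also have "\<dots> = (\<Sum>k=0..n. c k * falling_fact x (Suc k))
        + (\<Sum>k=0..n. (real k - real n * \<mu>) * c k * falling_fact x k)"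
      by (rule sum.distrib)
    also have "(\<Sum>k=0..n. c k * falling_fact x (Suc k))
        = (\<Sum>k=0..Suc n. (if k = 0 then 0 else c (k - 1)) * falling_fact x k)"
      by (subst sum.atLeast0_atMost_Suc_shift) simp
    also have "(\<Sum>k=0..n. (real k - real n * \<mu>) * c k * falling_fact x k)
        = (\<Sum>k=0..Suc n. (real k - real n * \<mu>) * c k * falling_fact x k)"
      by (simp add: z)
    finally show ?thesis
      by (simp only: d_def distrib_right sum.distrib)
  qed
  moreover have "d k = 0" if "k > Suc n" for k
    using that by (simp add: d_def z)
  ultimately show ?case by blast
qed

lemma falling_fact_coeff_unique:
  assumes "\<And>x. (\<Sum>k=0..n. c k * falling_fact x k) = (\<Sum>k=0..n. d k * falling_fact x k)"
  shows "m \<le> n \<Longrightarrow> c m = d m"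
proof (induction m rule: less_induct)
  case (less m)
  have *: "(\<Sum>k=0..n. b k * falling_fact (real m) k)
      = (\<Sum>k<m. b k * falling_fact (real m) k) + b m * falling_fact (real m) m" for b
  proof -
    have "(\<Sum>k=0..n. b k * falling_fact (real m) k) = (\<Sum>k\<in>{..<Suc m}. b k * falling_fact (real m) k)"
      using less.prems by (intro sum.mono_neutral_right) (auto simp: falling_fact_eq_0)
    then show ?thesis by simp
  qed
  have "(\<Sum>k<m. c k * falling_fact (real m) k) = (\<Sum>k<m. d k * falling_fact (real m) k)"
    using less by (intro sum.cong) auto
  with assms[of "real m"] have "c m * falling_fact (real m) m = d m * falling_fact (real m) m"
    by (simp add: *)
  then show ?case using falling_fact_self_nz by simp
qed

lemma degen_Stirling2_ex1:
  "\<exists>!c. (\<forall>x. degen_ffact \<mu> x n = (\<Sum>k=0..n. c k * falling_fact x k)) \<and> (\<forall>k>n. c k = (0::real))"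
proof (rule ex_ex1I[OF degen_Stirling2_ex], rule ext)
  fix c d :: "nat \<Rightarrow> real" and m :: nat
  assume c: "(\<forall>x. degen_ffact \<mu> x n = (\<Sum>k=0..n. c k * falling_fact x k)) \<and> (\<forall>k>n. c k = 0)"
    and d: "(\<forall>x. degen_ffact \<mu> x n = (\<Sum>k=0..n. d k * falling_fact x k)) \<and> (\<forall>k>n. d k = 0)"
  show "c m = d m"
  proof (cases "m \<le> n")
    case True
    have "(\<Sum>k=0..n. c k * falling_fact x k) = (\<Sum>k=0..n. d k * falling_fact x k)" for x
      using conjunct1[OF c, rule_format, of x] conjunct1[OF d, rule_format, of x] by (rule trans[OF sym])
    from falling_fact_coeff_unique[OF this True] show ?thesis .
  qed (use c d in simp)
qed

lemma degen_Stirling2_expansion: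
  "degen_ffact \<mu> x n = (\<Sum>k=0..n. degen_Stirling2 \<mu> n k * falling_fact x k)"
  using theI'[OF degen_Stirling2_ex1[of \<mu> n]] unfolding degen_Stirling2_def by blast

end

theory Submission
  imports Defs
begin

text \<open>The reflection $(x)_{r,\lambda} = (-1)^r (-x)_{r,-\lambda}$ followed by the defining
  expansion of $(-x)_{r,-\lambda}$ writes $(k)_{r,\lambda}$ as a combination of the rising factorials
  $(-1)^j (-k)_j = j! \binom{k+j-1}{j}$, whose sums over $k$ telescope by Pascal's rule. The term
  $j = 0$, where this summation would give $n + 1$ instead of $\binom{n}{1}$, vanishes
  for $r \ge 1$.\<close>

lemma degen_ffact_uminus: "degen_ffact \<mu> (- x) n = (-1) ^ n * degen_ffact (- \<mu>) x n"
  by (induction n) (simp_all add: degen_ffact_Suc algebra_simps)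

lemma degen_ffact_zero: "0 < n \<Longrightarrow> degen_ffact \<mu> 0 n = 0"
  by (auto simp: degen_ffact_def)

text \<open>Evaluate the defining expansion at \<open>x = 0\<close>: every falling factorial of
  positive order vanishes there.\<close>

lemma degen_Stirling2_0_right:
  assumes "0 < n"
  shows "degen_Stirling2 \<mu> n 0 = 0"
proof -
  have "0 = (\<Sum>k=0..n. degen_Stirling2 \<mu> n k * falling_fact 0 k)"
    using degen_Stirling2_expansion[of \<mu> 0 n] degen_ffact_zero[OF assms] by simp
  also have "\<dots> = degen_Stirling2 \<mu> n 0"
    by (simp add: sum.atLeast_Suc_atMost degen_ffact_zero)
  finally show ?thesis by simp
qed

text \<open>Parameter \<open>-1\<close> gives rising factorials; the argument \<open>Suc m\<close>
  avoids a truncated \<open>k + j - 1\<close>.\<close>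

lemma rising_fact_Suc_eq_binomial:
  "degen_ffact (-1) (real (Suc m)) j = fact j * real ((m + j) choose j)"
proof (induction j)
  case (Suc j)
  \<comment> \<open>Absorption identity for binomials; \<open>Suc (m + j)\<close> is the factor
    gained from \<open>j\<close> to \<open>Suc j\<close>.\<close>
  have "real (Suc (m + j)) * real ((m + j) choose j)
      = real (Suc j) * real (Suc (m + j) choose Suc j)"
    by (metis Suc_times_binomial_eq mult.commute of_nat_mult)
  with Suc show ?case
    by (simp add: degen_ffact_Suc algebra_simps)
qed simp

lemma sum_rising_fact:
  assumes "0 < j"
  shows "(\<Sum>k=0..n. degen_ffact (-1) (real k) j) = fact j * real ((n + j) choose (j + 1))"
proof (induction n)
  case 0
  show ?case using assms by (simp add: degen_ffact_zero)
next
  case (Suc n)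
  \<comment> \<open>Pascal's rule on \<open>Suc (n + j)\<close>. Keeping \<open>real (Suc n)\<close>
    folded lets the closed form of the new summand apply.\<close>
  then show ?case
    by (simp add: rising_fact_Suc_eq_binomial distrib_left del: of_nat_Suc)
qed

lemma degen_ffact_expansion_rising:
  "degen_ffact \<mu> x r
     = (\<Sum>j=0..r. (-1) ^ (r - j) * degen_Stirling2 (- \<mu>) r j * degen_ffact (-1) x j)"
proof -
  have "degen_ffact \<mu> x r = (-1) ^ r * degen_ffact (- \<mu>) (- x) r"
    by (simp add: degen_ffact_uminus flip: mult.assoc power_add)
  also have "\<dots> = (\<Sum>j=0..r. (-1) ^ r * (degen_Stirling2 (- \<mu>) r j * falling_fact (- x) j))"
    by (simp add: degen_Stirling2_expansion[of "- \<mu>"] sum_distrib_left)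
  also have "\<dots> = (\<Sum>j=0..r. (-1) ^ (r - j) * degen_Stirling2 (- \<mu>) r j * degen_ffact (-1) x j)"
  proof (rule sum.cong)
    fix j assume "j \<in> {0..r}"
    \<comment> \<open>The sign \<open>(-1) ^ j\<close> comes from reflecting
      \<open>falling_fact (- x) j\<close>; as \<open>j \<le> r\<close>, \<open>r + j\<close> and
      \<open>r - j\<close> have equal parity.\<close>
    then have "(-1 :: real) ^ r * (-1) ^ j = (-1) ^ (r - j)"
      by (simp add: minus_one_power_iff)
    then show "(-1) ^ r * (degen_Stirling2 (- \<mu>) r j * falling_fact (- x) j)
        = (-1) ^ (r - j) * degen_Stirling2 (- \<mu>) r j * degen_ffact (-1) x j"
      by (simp add: degen_ffact_uminus ac_simps flip: \<open>_ = (-1) ^ (r - j)\<close>)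
  qed simp
  finally show ?thesis .
qed

theorem theorem2p16:
  fixes lam :: real and r n :: nat
  assumes "lam \<noteq> 0" and "r \<ge> 1"
  shows "(\<Sum>k=0..n. degen_ffact lam (real k) r) =
         (\<Sum>j=0..r. (-1) ^ (r - j) * fact j * degen_Stirling2 (- lam) r j
                      * real ((n + j) choose (j + 1)))"
proof -
  have "(\<Sum>k=0..n. degen_ffact lam (real k) r)
      = (\<Sum>j=0..r. (-1) ^ (r - j) * degen_Stirling2 (- lam) r j
                    * (\<Sum>k=0..n. degen_ffact (-1) (real k) j))"
    unfolding degen_ffact_expansion_rising[of lam] sum_distrib_left by (rule sum.swap)
  also have "\<dots> = (\<Sum>j=0..r. (-1) ^ (r - j) * fact j * degen_Stirling2 (- lam) r j
                      * real ((n + j) choose (j + 1)))"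
  proof (rule sum.cong)
    fix j
    show "(-1) ^ (r - j) * degen_Stirling2 (- lam) r j * (\<Sum>k=0..n. degen_ffact (-1) (real k) j)
        = (-1) ^ (r - j) * fact j * degen_Stirling2 (- lam) r j * real ((n + j) choose (j + 1))"
    proof (cases "j = 0")
      case True
      with assms show ?thesis by (simp add: degen_Stirling2_0_right)
    next
      case False
      then show ?thesis by (simp add: sum_rising_fact)
    qed
  qed simp
  finally show ?thesis .
qed

end
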